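(* Let $A,B\in\mathbb{R}^{n\times n}$ and $b\in\mathbb{R}^n$ be such that the generalized absolute value equation $Ax-B|x|=b$ has a unique solution $x^{\ast}\in\mathbb{R}^n$. Let $A+B$ be an $H_{+}$-matrix, and let $\Omega\in\mathbb{R}^{n\times n}$ be a positive diagonal matrix (a diagonal matrix with positive diagonal entries). If $\langle A+B\rangle-2|B|$ is a nonsingular $M$-matrix, then the maximum-based iteration method $$x^{k+1}=(A+B+\Omega)^{-1}\bigl(\Omega x^{k}+2B\max\{0,x^{k}\}+b\bigr),\quad k=0,1,2,\ldots,$$ is convergent, i.e., for every initial vector $x^{0}\in\mathbb{R}^n$ the sequence $\{x^k\}$ converges to $x^{\ast}$.
   Context: For a vector or matrix $X$ with real entries, $|X|$ denotes the entrywise absolute value, and matrix inequalities such as $X\ge 0$ are entrywise. For $x\in\mathbb{R}^n$, $\max\{0,x\}$ is the entrywise maximum of $x$ and the zero vector. A matrix $C=(c_{ij})\in\mathbb{R}^{n\times n}$ is a $Z$-matrix if $c_{ij}\le 0$ for all $i\ne j$; a nonsingular $M$-matrix if it is a $Z$-matrix, is invertible, and $C^{-1}\ge 0$. The comparison matrix $\langle C\rangle=(\langle c_{ij}\rangle)$ of $C$ is given by $\langle c_{ii}\rangle=|c_{ii}|$ and $\langle c_{ij}\rangle=-|c_{ij}|$ for $i\neq j$. $C$ is an $H$-matrix if $\langle C\rangle$ is a nonsingular $M$-matrix, and an $H_{+}$-matrix if it is an $H$-matrix with positive diagonal entries. *)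

theory Defs
  imports "HOL-Analysis.Analysis"
begin

(* On real ^ 'n and real ^ 'n ^ 'n the library orders vectors and matrices entrywise, so
   "0 \<le> X", "\<bar>X\<bar>" and "sup 0 x" are the entrywise notions. "max 0 x" is not: max
   branches on 0 \<le> x for the whole vector. *)

lemma abs_vec_component: "\<bar>x :: real ^ 'n\<bar> $ i = \<bar>x $ i\<bar>"
  by (simp add: abs_vec_def)

lemma abs_matrix_component: "\<bar>X :: real ^ 'n ^ 'm\<bar> $ i $ j = \<bar>X $ i $ j\<bar>"
  by (simp add: abs_vec_def)

lemma sup_zero_component: "sup 0 (x :: real ^ 'n) $ i = max 0 (x $ i)"
  by (simp add: sup_vec_def sup_max)

lemma nonneg_matrix_iff: "0 \<le> (X :: real ^ 'n ^ 'm) \<longleftrightarrow> (\<forall>i j. 0 \<le> X $ i $ j)"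
  by (simp add: less_eq_vec_def)

definition Z_matrix :: "real ^ 'n ^ 'n \<Rightarrow> bool" where
  "Z_matrix C \<longleftrightarrow> (\<forall>i j. i \<noteq> j \<longrightarrow> C $ i $ j \<le> 0)"

definition nonsingular_M_matrix :: "real ^ 'n ^ 'n \<Rightarrow> bool" where
  "nonsingular_M_matrix C \<longleftrightarrow> Z_matrix C \<and> invertible C \<and> 0 \<le> matrix_inv C"

definition comparison_matrix :: "real ^ 'n ^ 'n \<Rightarrow> real ^ 'n ^ 'n" where
  "comparison_matrix C = (\<chi> i j. if i = j then \<bar>C $ i $ j\<bar> else - \<bar>C $ i $ j\<bar>)"

definition H_matrix :: "real ^ 'n ^ 'n \<Rightarrow> bool" where
  "H_matrix C \<longleftrightarrow> nonsingular_M_matrix (comparison_matrix C)"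

definition H_plus_matrix :: "real ^ 'n ^ 'n \<Rightarrow> bool" where
  "H_plus_matrix C \<longleftrightarrow> H_matrix C \<and> (\<forall>i. 0 < C $ i $ i)"

definition positive_diagonal_matrix :: "real ^ 'n ^ 'n \<Rightarrow> bool" where
  "positive_diagonal_matrix D \<longleftrightarrow>
     (\<forall>i j. i \<noteq> j \<longrightarrow> D $ i $ j = 0) \<and> (\<forall>i. 0 < D $ i $ i)"

end

theory Submission
  imports Defs
begin

text \<open>
  The vector \<open>v = (\<langle>A + B\<rangle> - 2 |B|)\<^sup>-\<^sup>1 e\<close>, where \<open>e\<close> is the all-ones vector, is
  positive and satisfies \<open>\<langle>A + B + \<Omega>\<rangle> v = e + q\<close> with \<open>q = \<Omega> v + 2 |B| v \<ge> 0\<close>.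
  If the error of \<open>x\<^sup>k\<close> is at most \<open>s v\<close> entrywise, then \<open>A + B + \<Omega>\<close> applied to the next
  error is at most \<open>s q\<close>, and a weighted diagonal dominance argument bounds the next error by
  \<open>s \<rho> v\<close> as soon as \<open>q \<le> \<rho> (e + q)\<close>; some \<open>\<rho> < 1\<close> has this property.
\<close>

lemma matrix_mult_matrix_inv:
  assumes "invertible D"
  shows "D ** matrix_inv D = mat 1"
  using someI_ex[OF assms[unfolded invertible_def]] by (simp add: matrix_inv_def)

text \<open>Applying the nonnegative inverse \<open>N\<close> to the all-ones vector yields its row
  sums. A vanishing row sum would force a whole row of \<open>N\<close> to vanish, contradicting
  \<open>N ** M = mat 1\<close>; hence every entry is positive.\<close>

lemma nonsingular_M_matrix_positive_vector:
  fixes M :: "real ^ 'n ^ 'n"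
  assumes "nonsingular_M_matrix M"
  obtains v where "\<And>i. 0 < v $ i" "\<And>i. (M *v v) $ i = 1"
proof
  define N where "N = matrix_inv M"
  have inv: "M ** N = mat 1" and nonneg: "\<And>i j. 0 \<le> N $ i $ j"
    using assms by (simp_all add: N_def nonsingular_M_matrix_def nonneg_matrix_iff matrix_mult_matrix_inv)
  have inv': "N ** M = mat 1"
    using inv by (simp add: matrix_left_right_inverse)
  define v where "v = N *v (\<chi> i. 1)"
  show "(M *v v) $ i = 1" for i
    by (simp add: v_def matrix_vector_mul_assoc inv)
  show "0 < v $ i" for i
  proof -
    have v_i: "v $ i = (\<Sum>j\<in>UNIV. N $ i $ j)"
      by (simp add: v_def matrix_vector_mult_def)
    have "v $ i \<noteq> 0"
    proof
      assume "v $ i = 0"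
      then have "\<forall>j. N $ i $ j = 0"
        using nonneg by (simp add: v_i sum_nonneg_eq_0_iff)
      then have "(N ** M) $ i $ i = 0"
        by (simp add: matrix_matrix_mult_def)
      then show False
        by (simp add: inv' mat_def)
    qed
    moreover have "0 \<le> v $ i"
      unfolding v_i by (intro sum_nonneg nonneg)
    ultimately show ?thesis by simp
  qed
qed

lemma matrix_vector_mult_abs_le:
  fixes D :: "real ^ 'n ^ 'm"
  assumes "\<And>j. \<bar>y $ j\<bar> \<le> s * v $ j"
  shows "\<bar>(D *v y) $ i\<bar> \<le> s * (\<bar>D\<bar> *v v) $ i"
proof -
  have "\<bar>(D *v y) $ i\<bar> \<le> (\<Sum>j\<in>UNIV. \<bar>D $ i $ j * y $ j\<bar>)"
    by (simp add: matrix_vector_mult_def sum_abs)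
  also have "\<dots> \<le> (\<Sum>j\<in>UNIV. s * (\<bar>D $ i $ j\<bar> * v $ j))"
    by (intro sum_mono) (metis abs_ge_zero abs_mult assms mult.left_commute mult_left_mono)
  finally show ?thesis
    by (simp add: matrix_vector_mult_def abs_matrix_component sum_distrib_left)
qed

lemma matrix_vector_mult_remove:
  fixes D :: "real ^ 'n ^ 'n"
  shows "(D *v y) $ i = D $ i $ i * y $ i + (\<Sum>j\<in>UNIV - {i}. D $ i $ j * y $ j)"
  by (simp add: matrix_vector_mult_def sum.remove[of UNIV i])

lemma comparison_matrix_mult:
  "(comparison_matrix D *v v) $ i = \<bar>D $ i $ i\<bar> * v $ i - (\<Sum>j\<in>UNIV - {i}. \<bar>D $ i $ j\<bar> * v $ j)"
proof -
  have "(\<Sum>j\<in>UNIV - {i}. comparison_matrix D $ i $ j * v $ j)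
      = (\<Sum>j\<in>UNIV - {i}. - (\<bar>D $ i $ j\<bar> * v $ j))"
    by (intro sum.cong) (auto simp: comparison_matrix_def)
  then show ?thesis
    by (simp add: matrix_vector_mult_remove sum_negf) (simp add: comparison_matrix_def)
qed

text \<open>In a row \<open>i\<close> where \<open>\<bar>y $ j\<bar> / v $ j\<close> attains its
  maximum \<open>m\<close>, the diagonal term outweighs the others, so that
  \<open>\<bar>(D *v y) $ i\<bar>\<close> is at least \<open>m\<close> times the positive number
  \<open>(comparison_matrix D *v v) $ i\<close>. Comparing with \<open>le\<close> gives
  \<open>m \<le> t\<close>. This plays the role of a bound on the inverse of \<open>D\<close> in the
  max norm weighted by \<open>v\<close>.\<close>

lemma comparison_matrix_abs_le:
  fixes D :: "real ^ 'n ^ 'n"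
  assumes pos: "\<And>i. 0 < v $ i"
    and dom: "\<And>i. 0 < (comparison_matrix D *v v) $ i"
    and le: "\<And>i. \<bar>(D *v y) $ i\<bar> \<le> t * (comparison_matrix D *v v) $ i"
  shows "\<bar>y $ l\<bar> \<le> t * v $ l"
proof -
  define m where "m = Max (range (\<lambda>j. \<bar>y $ j\<bar> / v $ j))"
  have "m \<in> range (\<lambda>j. \<bar>y $ j\<bar> / v $ j)"
    unfolding m_def by (intro Max_in) auto
  then obtain i where "m = \<bar>y $ i\<bar> / v $ i"
    by auto
  then have y_i: "\<bar>y $ i\<bar> = m * v $ i"
    using pos[of i] by simp
  have y_le: "\<bar>y $ j\<bar> \<le> m * v $ j" for j
  proof -
    have "\<bar>y $ j\<bar> / v $ j \<le> m"
      unfolding m_def by (intro Max_ge) auto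
    then show ?thesis
      using pos[of j] by (simp add: pos_divide_le_eq)
  qed
  \<comment> \<open>The off-diagonal part of row \<open>i\<close> is bounded through
    \<open>y_le\<close>, while the diagonal part is known exactly from \<open>y_i\<close>.\<close>
  have "\<bar>\<Sum>j\<in>UNIV - {i}. D $ i $ j * y $ j\<bar> \<le> (\<Sum>j\<in>UNIV - {i}. \<bar>D $ i $ j * y $ j\<bar>)"
    by (rule sum_abs)
  also have "\<dots> \<le> (\<Sum>j\<in>UNIV - {i}. m * (\<bar>D $ i $ j\<bar> * v $ j))"
    by (intro sum_mono) (metis abs_ge_zero abs_mult y_le mult.left_commute mult_left_mono)
  also have "\<dots> = m * (\<Sum>j\<in>UNIV - {i}. \<bar>D $ i $ j\<bar> * v $ j)"
    by (simp add: sum_distrib_left)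
  finally have "m * (comparison_matrix D *v v) $ i
      \<le> \<bar>D $ i $ i * y $ i\<bar> - \<bar>\<Sum>j\<in>UNIV - {i}. D $ i $ j * y $ j\<bar>"
    by (simp add: comparison_matrix_mult abs_mult y_i algebra_simps)
  also have "\<dots> \<le> \<bar>(D *v y) $ i\<bar>"
    unfolding matrix_vector_mult_remove by linarith
  also have "\<dots> \<le> t * (comparison_matrix D *v v) $ i"
    by (rule le)
  finally have "m \<le> t"
    using dom[of i] by simp
  then have "m * v $ l \<le> t * v $ l"
    using pos[of l] by simp
  with y_le[of l] show ?thesis
    by linarith
qed

text \<open>The preceding bound with \<open>t = 0\<close> shows that the kernel of \<open>D\<close>
  is trivial.\<close>

lemma comparison_matrix_dominant_invertible:
  fixes D :: "real ^ 'n ^ 'n"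
  assumes "\<And>i. 0 < v $ i" and "\<And>i. 0 < (comparison_matrix D *v v) $ i"
  shows "invertible D"
proof -
  have "y = 0" if "D *v y = 0" for y
    using comparison_matrix_abs_le[OF assms, of y 0] that by (simp add: vec_eq_iff)
  then show ?thesis
    by (simp add: invertible_left_inverse matrix_left_invertible_ker)
qed

lemma positive_diagonal_matrix_mult:
  assumes "positive_diagonal_matrix D"
  shows "(D *v x) $ i = D $ i $ i * x $ i"
proof -
  have "(\<Sum>j\<in>UNIV - {i}. D $ i $ j * x $ j) = 0"
    using assms by (intro sum.neutral) (auto simp: positive_diagonal_matrix_def)
  then show ?thesis
    by (simp add: matrix_vector_mult_remove)
qed

text \<open>Both diagonals are positive, so their absolute values add without cancellation; off the
  diagonal \<open>D\<close> contributes nothing.\<close>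

lemma comparison_matrix_add_diagonal:
  assumes "H_plus_matrix C" and "positive_diagonal_matrix D"
  shows "comparison_matrix (C + D) = comparison_matrix C + D"
  using assms
  by (auto simp: comparison_matrix_def vec_eq_iff H_plus_matrix_def positive_diagonal_matrix_def
      less_imp_le add_nonneg_nonneg)

text \<open>The identity 2 max{0,x} = |x| + x turns the absolute value equation into the fixed point
  equation of the iteration.\<close>

lemma gave_fixed_point:
  fixes A B \<Omega> :: "real ^ 'n ^ 'n"
  assumes "A *v x - B *v \<bar>x\<bar> = b"
  shows "(A + B + \<Omega>) *v x = \<Omega> *v x + (2 *\<^sub>R B) *v sup 0 x + b"
proof -
  have "2 *\<^sub>R sup 0 x = \<bar>x\<bar> + x"
    by (simp add: vec_eq_iff sup_zero_component abs_vec_component max_def)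
  then have "(2 *\<^sub>R B) *v sup 0 x = B *v \<bar>x\<bar> + B *v x"
    by (metis matrix_vector_mult_scaleR matrix_vector_right_distrib scaleR_matrix_vector_assoc)
  then show ?thesis
    using assms by (simp add: matrix_vector_mult_add_rdistrib algebra_simps)
qed

theorem theorem2p4:
  fixes A B \<Omega> :: "real ^ 'n ^ 'n" and b xstar :: "real ^ 'n"
  assumes "\<exists>!x. A *v x - B *v \<bar>x\<bar> = b"
    and "A *v xstar - B *v \<bar>xstar\<bar> = b"
    and "H_plus_matrix (A + B)"
    and "positive_diagonal_matrix \<Omega>"
    and "nonsingular_M_matrix (comparison_matrix (A + B) - 2 *\<^sub>R \<bar>B\<bar>)"
  shows "invertible (A + B + \<Omega>) \<and>
    (\<forall>x :: nat \<Rightarrow> real ^ 'n.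
      (\<forall>k. x (Suc k) = matrix_inv (A + B + \<Omega>) *v
                 (\<Omega> *v x k + (2 *\<^sub>R B) *v sup 0 (x k) + b))
      \<longrightarrow> x \<longlonglongrightarrow> xstar)"
proof -
  define E where "E = A + B + \<Omega>"
  obtain v where pos: "\<And>i. 0 < v $ i"
    and one: "\<And>i. ((comparison_matrix (A + B) - 2 *\<^sub>R \<bar>B\<bar>) *v v) $ i = 1"
    using assms(5) by (rule nonsingular_M_matrix_positive_vector) blast
  define q where "q i = \<Omega> $ i $ i * v $ i + 2 * (\<bar>B\<bar> *v v) $ i" for i
  have \<Omega>_pos: "0 < \<Omega> $ i $ i" for i
    using assms(4) by (simp add: positive_diagonal_matrix_def)
  have q_nonneg: "0 \<le> q i" for i
    using pos \<Omega>_pos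
    by (auto simp: q_def matrix_vector_mult_def abs_matrix_component less_imp_le
        intro!: add_nonneg_nonneg sum_nonneg mult_nonneg_nonneg)
  \<comment> \<open>The term \<open>2 * (\<bar>B\<bar> *v v) $ i\<close> in \<open>q i\<close>
    compensates the one subtracted in \<open>one\<close>, and the other term comes from adding
    \<open>\<Omega>\<close>.\<close>
  have comp: "(comparison_matrix E *v v) $ i = 1 + q i" for i
    using one[of i]
    by (simp add: E_def q_def comparison_matrix_add_diagonal[OF assms(3,4)]
        matrix_vector_mult_add_rdistrib matrix_vector_mult_diff_rdistrib
        positive_diagonal_matrix_mult[OF assms(4)] scaleR_matrix_vector_assoc[symmetric])
  have dom: "0 < (comparison_matrix E *v v) $ i" for i
    using q_nonneg[of i] by (simp add: comp)
  have inv: "invertible E"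
    using pos dom by (rule comparison_matrix_dominant_invertible)

  define Q where "Q = Max (range q)"
  \<comment> \<open>Since t / (1 + t) increases for t \<ge> 0, its value at the largest
    \<open>q i\<close> bounds every ratio \<open>q i / (1 + q i)\<close> and stays below 1.\<close>
  define \<rho> where "\<rho> = Q / (1 + Q)"
  have q_le: "q i \<le> Q" for i
    unfolding Q_def by (intro Max_ge) auto
  have Q_nonneg: "0 \<le> Q"
    using q_nonneg q_le order_trans by blast
  then have \<rho>: "0 \<le> \<rho>" "\<rho> < 1"
    by (simp_all add: \<rho>_def)
  have q_le_\<rho>: "q i \<le> \<rho> * (1 + q i)" for i
    using q_le[of i] Q_nonneg by (simp add: \<rho>_def field_simps)

  have "x \<longlonglongrightarrow> xstar"
    if x: "\<And>k. x (Suc k) = matrix_inv E *v (\<Omega> *v x k + (2 *\<^sub>R B) *v sup 0 (x k) + b)"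
    for x :: "nat \<Rightarrow> real ^ 'n"
  proof -
    have err: "E *v (x (Suc k) - xstar)
        = \<Omega> *v (x k - xstar) + (2 *\<^sub>R B) *v (sup 0 (x k) - sup 0 xstar)" for k
    proof -
      have "E *v x (Suc k) = \<Omega> *v x k + (2 *\<^sub>R B) *v sup 0 (x k) + b"
        by (simp add: x matrix_vector_mul_assoc matrix_mult_matrix_inv[OF inv])
      then show ?thesis
        using gave_fixed_point[OF assms(2), of \<Omega>]
        by (simp add: E_def matrix_vector_mult_diff_distrib algebra_simps)
    qed
    have step: "\<bar>(x (Suc k) - xstar) $ i\<bar> \<le> (s * \<rho>) * v $ i"
      if le: "\<And>i. \<bar>(x k - xstar) $ i\<bar> \<le> s * v $ i" and s: "0 \<le> s" for k s i
    proof (rule comparison_matrix_abs_le[OF pos dom])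
      fix i
      \<comment> \<open>The positive part is nonexpansive in each component.\<close>
      have "\<bar>(sup 0 (x k) - sup 0 xstar) $ j\<bar> \<le> s * v $ j" for j
        using le[of j] by (simp add: sup_zero_component)
      then have "\<bar>(B *v (sup 0 (x k) - sup 0 xstar)) $ i\<bar> \<le> s * (\<bar>B\<bar> *v v) $ i"
        by (rule matrix_vector_mult_abs_le)
      moreover have "\<bar>(\<Omega> *v (x k - xstar)) $ i\<bar> \<le> s * (\<Omega> $ i $ i * v $ i)"
        using mult_left_mono[OF le[of i], of "\<Omega> $ i $ i"] \<Omega>_pos[of i]
        by (simp add: positive_diagonal_matrix_mult[OF assms(4)] abs_mult mult.left_commute)
      ultimately have "\<bar>(E *v (x (Suc k) - xstar)) $ i\<bar> \<le> s * q i"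
        by (simp add: err q_def scaleR_matrix_vector_assoc[symmetric] distrib_left)
      also have "\<dots> \<le> s * (\<rho> * (1 + q i))"
        using q_le_\<rho> s by (rule mult_left_mono)
      finally show "\<bar>(E *v (x (Suc k) - xstar)) $ i\<bar> \<le> (s * \<rho>) * (comparison_matrix E *v v) $ i"
        by (simp add: comp mult.assoc)
    qed
    \<comment> \<open>This is the weighted max norm of the initial error, the least factor with
      which \<open>v\<close> dominates it.\<close>
    define s where "s = Max (range (\<lambda>i. \<bar>(x 0 - xstar) $ i\<bar> / v $ i))"
    have s_ge: "\<bar>(x 0 - xstar) $ i\<bar> / v $ i \<le> s" for i
      unfolding s_def by (intro Max_ge) auto
    have s_nonneg: "0 \<le> s"
      using s_ge pos by (meson abs_ge_zero divide_nonneg_pos order_trans)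
    have bound: "\<bar>(x k - xstar) $ i\<bar> \<le> (s * \<rho> ^ k) * v $ i" for k i
    \<comment> \<open>The index is generalized because \<open>step\<close> needs the previous bound
      in all components at once.\<close>
    proof (induction k arbitrary: i)
      case 0
      then show ?case
        using s_ge[of i] pos[of i] by (simp add: pos_divide_le_eq)
    next
      case (Suc k)
      then show ?case
        using step[of k "s * \<rho> ^ k" i] s_nonneg \<rho>(1) by (simp add: ac_simps)
    qed
    have "(\<lambda>k. x k $ i) \<longlonglongrightarrow> xstar $ i" for i
    proof -
      have "(\<lambda>k. (s * \<rho> ^ k) * v $ i) \<longlonglongrightarrow> (s * 0) * v $ i"
        using \<rho> by (intro tendsto_intros LIMSEQ_power_zero) auto
      then have "(\<lambda>k. x k $ i - xstar $ i) \<longlonglongrightarrow> 0"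
        using bound by (intro Lim_null_comparison[of "\<lambda>k. x k $ i - xstar $ i"]) auto
      then show ?thesis
        by (simp add: LIM_zero_iff)
    qed
    then show ?thesis
      by (rule vec_tendstoI)
  qed
  with inv show ?thesis
    unfolding E_def by blast
qed

end
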